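(* Let $E$ be a symmetric $d$-regular EEA over $\mathbb{R}$ with natural basis $\mathcal{B}$ and structural matrix $A=(a_{ij})$ satisfying, for some constant $c>0$, $a_{ij}=c$ for all edges $\{i,j\}$ of $\Gamma(E,\mathcal{B})$, $a_{ij}=0$ otherwise, and $a_{ii}=0$. Let $\lambda_1\ge\lambda_2\ge\cdots\ge\lambda_n$ be the eigenvalues of $A$. Then $\lambda_1=cd$ and $$\frac{(cd)^2\,\mathfrak{h}(E,\mathcal{B})^2}{2d^2\lambda_1}\le\lambda_1-\lambda_2\le 2c\,\mathfrak{h}(E,\mathcal{B}).$$ In particular, $\lambda_1-\lambda_2\ge c\,\mathfrak{h}(E,\mathcal{B})^2/(2d)$.
   Context: An evolution algebra over $\mathbb{R}$ (finite-dimensional) is an algebra $E$ with a linear basis $\mathcal{B}=\{e_1,\dots,e_n\}$ (a natural basis) such that $e_ie_j=0$ for $i\neq j$ and $e_i^2=\sum_k a_{ik}e_k$ with $a_{ik}\in\mathbb{R}$; $A=(a_{ik})$ is the structural matrix. It is symmetric if $a_{ij}=a_{ji}$ for all $i\ne j$. The graph $\Gamma(E,\mathcal{B})$ is the simple graph with vertex set $\{1,\dots,n\}$ and edges $\{i,j\}$, $i\ne j$, whenever $a_{ij}\neq0$ or $a_{ji}\ne0$. $E$ is $d$-regular if every vertex of $\Gamma(E,\mathcal{B})$ has exactly $d$ neighbours. For a finite simple graph $\Gamma$ with vertex set $V$ and $W\subseteq V$, let $E(W)$ be the set of edges with exactly one endpoint in $W$; the Cheeger constant is $\mathfrak{h}(\Gamma)=\min\{|E(W)|/|W|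 : \emptyset\ne W\subsetneq V,\ |W|\le |V|/2\}$, with $\mathfrak{h}(\Gamma)=+\infty$ if $|V|\le1$. Put $\mathfrak{h}(E,\mathcal{B})=\mathfrak{h}(\Gamma(E,\mathcal{B}))$. $E$ is an EEA (Expander Evolution Algebra) if $\mathfrak{h}(E,\mathcal{B})>0$. *)

theory Defs
  imports "HOL-Analysis.Linear_Algebra" "HOL-Library.Extended_Real"
    "Jordan_Normal_Form.Char_Poly"
begin

section \<open>Finite simple graphs and the Cheeger constant\<close>

text \<open>A graph is a pair of a vertex set and a set of edges, an edge being an unordered
  pair of distinct vertices, i.e. a two-element set.\<close>

type_synonym 'v graph = "'v set \<times> 'v set set"

definition neighbours :: "'v graph \<Rightarrow> 'v \<Rightarrow> 'v set" where
  "neighbours G v = {w \<in> fst G. {v, w} \<in> snd G}"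

definition regular_graph :: "nat \<Rightarrow> 'v graph \<Rightarrow> bool" where
  "regular_graph d G \<longleftrightarrow> (\<forall>v \<in> fst G. card (neighbours G v) = d)"

definition edge_boundary :: "'v graph \<Rightarrow> 'v set \<Rightarrow> 'v set set" where
  "edge_boundary G W = {f \<in> snd G. card (f \<inter> W) = 1}"

text \<open>Extended reals, because the constant is infinite on at most one vertex. In the other
  case the set below is finite and nonempty (it contains the value at any singleton).\<close>

definition cheeger :: "'v graph \<Rightarrow> ereal" where
  "cheeger G =
    (if card (fst G) \<le> 1 then \<infinity>
     else Min {ereal (real (card (edge_boundary G W)) / real (card W)) | W.
            W \<noteq> {} \<and> W \<subset> fst G \<and> real (card W) \<le> real (card (fst G)) / 2})"

section \<open>Evolution algebras\<close>

text \<open>The algebra is the real vector space \<open>'a\<close> with a product \<open>mul\<close> that need not be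
  associative or unital. A natural basis of \<open>n\<close> elements is enumerated as
  \<open>e 0, \<dots>, e (n - 1)\<close>; values of \<open>e\<close> outside \<open>{..<n}\<close> are irrelevant.\<close>

definition natural_basis ::
    "('a::real_vector \<Rightarrow> 'a \<Rightarrow> 'a) \<Rightarrow> nat \<Rightarrow> (nat \<Rightarrow> 'a) \<Rightarrow> bool" where
  "natural_basis mul n e \<longleftrightarrow>
     inj_on e {..<n} \<and> independent (e ` {..<n}) \<and> span (e ` {..<n}) = UNIV \<and>
     (\<forall>i<n. \<forall>j<n. i \<noteq> j \<longrightarrow> mul (e i) (e j) = 0)"

definition evolution_algebra :: "('a::real_vector \<Rightarrow> 'a \<Rightarrow> 'a) \<Rightarrow> bool" where
  "evolution_algebra mul \<longleftrightarrow> bilinear mul \<and> (\<exists>n e. natural_basis mul n e)"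

text \<open>Row \<open>i\<close> holds the coordinates of the square of \<open>e i\<close> in the basis \<open>e\<close>.\<close>

definition structural_matrix ::
    "('a::real_vector \<Rightarrow> 'a \<Rightarrow> 'a) \<Rightarrow> nat \<Rightarrow> (nat \<Rightarrow> 'a) \<Rightarrow> real mat" where
  "structural_matrix mul n e =
     mat n n (\<lambda>(i, k). representation (e ` {..<n}) (mul (e i) (e i)) (e k))"

definition symmetric_evolution ::
    "('a::real_vector \<Rightarrow> 'a \<Rightarrow> 'a) \<Rightarrow> nat \<Rightarrow> (nat \<Rightarrow> 'a) \<Rightarrow> bool" where
  "symmetric_evolution mul n e \<longleftrightarrow>
     (\<forall>i<n. \<forall>j<n. i \<noteq> j \<longrightarrow>
        structural_matrix mul n e $$ (i, j) = structural_matrix mul n e $$ (j, i))"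

definition evolution_graph ::
    "('a::real_vector \<Rightarrow> 'a \<Rightarrow> 'a) \<Rightarrow> nat \<Rightarrow> (nat \<Rightarrow> 'a) \<Rightarrow> nat graph" where
  "evolution_graph mul n e =
     ({..<n},
      {{i, j} | i j. i < n \<and> j < n \<and> i \<noteq> j \<and>
         (structural_matrix mul n e $$ (i, j) \<noteq> 0 \<or> structural_matrix mul n e $$ (j, i) \<noteq> 0)})"

definition regular_evolution ::
    "nat \<Rightarrow> ('a::real_vector \<Rightarrow> 'a \<Rightarrow> 'a) \<Rightarrow> nat \<Rightarrow> (nat \<Rightarrow> 'a) \<Rightarrow> bool" where
  "regular_evolution d mul n e \<longleftrightarrow> regular_graph d (evolution_graph mul n e)"

definition cheeger_evolution ::
    "('a::real_vector \<Rightarrow> 'a \<Rightarrow> 'a) \<Rightarrow> nat \<Rightarrow> (nat \<Rightarrow> 'a) \<Rightarrow> ereal" where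
  "cheeger_evolution mul n e = cheeger (evolution_graph mul n e)"

definition expander_evolution_algebra ::
    "('a::real_vector \<Rightarrow> 'a \<Rightarrow> 'a) \<Rightarrow> nat \<Rightarrow> (nat \<Rightarrow> 'a) \<Rightarrow> bool" where
  "expander_evolution_algebra mul n e \<longleftrightarrow>
     evolution_algebra mul \<and> natural_basis mul n e \<and> cheeger_evolution mul n e > 0"

section \<open>Eigenvalues in decreasing order\<close>

text \<open>The real eigenvalues, repeated according to algebraic multiplicity. The list is
  0-based, so its entry at position \<open>k - 1\<close> is the \<open>k\<close>-th largest eigenvalue. It is shorter
  than the dimension if the characteristic polynomial does not split over the reals.\<close>

definition eigenvalues_desc :: "real mat \<Rightarrow> real list" where
  "eigenvalues_desc A = rev (sorted_list_of_multiset (proots (char_poly A)))"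

end

theory Submission
  imports Defs "HOL-Analysis.Convex" "Jordan_Normal_Form.Schur_Decomposition"
begin

text \<open>Diagonalise the symmetric matrix by an orthonormal basis. Row sums \<open>c * d\<close> make
  \<open>c * d\<close> the top eigenvalue, with the constant vector as eigenvector. For the upper bound, a
  combination of the constant vector and the indicator of an optimal set, chosen orthogonal to
  the first eigenvector, has Rayleigh quotient at most \<open>\<lambda>\<^sub>2\<close>. For the lower bound, take an
  eigenvector for \<open>\<lambda>\<^sub>2\<close> that sums to zero; up to a sign its positive part \<open>g\<close> lives on at most
  half of the vertices, and the coarea inequality for \<open>g\<^sup>2\<close>, combined with Cauchy--Schwarz,
  bounds the Cheeger constant by the Dirichlet energy of \<open>g\<close>.\<close>

section \<open>Spectral decomposition of real symmetric matrices\<close>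

lemma of_real_hom_prod_linear:
  "map_poly complex_of_real (\<Prod>a\<leftarrow>es. [:- a, 1:]) = (\<Prod>a\<leftarrow>map complex_of_real es. [:- a, 1:])"
proof -
  interpret map_poly_comm_ring_hom complex_of_real ..
  show ?thesis by (induct es) (simp_all add: hom_distribs del: mult_pCons_left)
qed

text \<open>Since \<open>A\<close> is real, the conjugate of an eigenvector \<open>v\<close> for
  \<open>z\<close> is an eigenvector for \<open>cnj z\<close>. By symmetry the matrix may act on
  either factor of \<open>v \<bullet> conjugate v\<close>, so \<open>z\<close> and
  \<open>cnj z\<close> times this nonzero number agree.\<close>

lemma symmetric_complex_eigenvalue_real:
  fixes A :: "real mat"
  assumes A: "A \<in> carrier_mat n n" and sym: "A\<^sup>T = A"
    and ev: "eigenvalue (map_mat complex_of_real A) z"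
  shows "Im z = 0"
proof -
  let ?C = "map_mat complex_of_real A"
  have C: "?C \<in> carrier_mat n n" using A by simp
  obtain v where v: "v \<in> carrier_vec n" and v0: "v \<noteq> 0\<^sub>v n" and Av: "?C *\<^sub>v v = z \<cdot>\<^sub>v v"
    using ev C unfolding eigenvalue_def eigenvector_def by auto
  have cv: "conjugate v \<in> carrier_vec n" using v by simp
  have "conjugate (?C *\<^sub>v v) = ?C *\<^sub>v conjugate v"
    by (rule eq_vecI) (use A v in \<open>auto simp: scalar_prod_def\<close>)
  then have Acv: "?C *\<^sub>v conjugate v = cnj z \<cdot>\<^sub>v conjugate v"
    unfolding Av by (metis conjugate_complex_def conjugate_smult_vec)
  have symC: "?C\<^sup>T = ?C"
    using sym by (metis map_mat_transpose)
  have "z * (v \<bullet> conjugate v) = (?C *\<^sub>v v) \<bullet> conjugate v"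
    unfolding Av using v by simp
  also have "\<dots> = v \<bullet> (?C *\<^sub>v conjugate v)"
    using transpose_vec_mult_scalar[OF C cv v] symC by (metis C comm_scalar_prod cv mult_mat_vec_carrier v)
  also have "\<dots> = cnj z * (v \<bullet> conjugate v)"
    unfolding Acv using v by simp
  finally have "(z - cnj z) * (v \<bullet>c v) = 0" by (simp add: algebra_simps)
  moreover have "v \<bullet>c v \<noteq> 0" using v v0 by (simp add: conjugate_square_eq_0_vec)
  ultimately have "z = cnj z" by simp
  then show ?thesis by (simp add: complex_eq_iff)
qed

text \<open>The characteristic polynomial factors over the complex numbers, where all roots are real
  by the preceding lemma. The factorisation then descends to the reals because the embedding is
  injective on coefficients.\<close>

lemma symmetric_char_poly_splits:
  fixes A :: "real mat"
  assumes A: "A \<in> carrier_mat n n" and sym: "A\<^sup>T = A"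
  obtains es where "char_poly A = (\<Prod>a\<leftarrow>es. [:- a, 1:])" "length es = n"
proof -
  let ?C = "map_mat complex_of_real A"
  have C: "?C \<in> carrier_mat n n" using A by simp
  obtain as where as: "char_poly ?C = (\<Prod>a\<leftarrow>as. [:- a, 1:])" "length as = n"
    using char_poly_factorized[OF C] by blast
  have "Im a = 0" if "a \<in> set as" for a
  proof (rule symmetric_complex_eigenvalue_real[OF A sym])
    show "eigenvalue ?C a"
      using that by (simp add: eigenvalue_root_char_poly[OF C] as poly_prod_list prod_list_zero_iff image_iff)
  qed
  then have real_as: "map complex_of_real (map Re as) = as"
    by (auto simp: complex_eq_iff intro!: map_idI)
  have "map_poly complex_of_real (char_poly A) = char_poly ?C"
    by (rule of_real_hom.char_poly_hom[OF A, symmetric])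
  also have "\<dots> = map_poly complex_of_real (\<Prod>a\<leftarrow>map Re as. [:- a, 1:])"
    unfolding of_real_hom_prod_linear real_as by (rule as)
  finally have "char_poly A = (\<Prod>a\<leftarrow>map Re as. [:- a, 1:])"
    by (simp add: poly_eq_iff coeff_map_poly)
  then show thesis using that[of "map Re as"] as(2) by simp
qed

lemma proots_prod_linear: "proots (\<Prod>a\<leftarrow>es. [:- a, 1:]) = mset (es :: 'a :: idom list)"
proof (induct es)
  case (Cons a es)
  have "(\<Prod>a\<leftarrow>es. [:- a, 1:]) \<noteq> 0" by (auto simp: prod_list_zero_iff)
  then show ?case using Cons by (simp add: proots_mult del: mult_pCons_left)
qed simp

text \<open>The product depends only on the multiset of roots, so any list of roots may be replaced
  by the sorted one. This lets the diagonalisation below be carried out in decreasing order.\<close>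

lemma eigenvalues_desc_split:
  assumes "char_poly A = (\<Prod>a\<leftarrow>es. [:- a, 1:])"
  shows "char_poly A = (\<Prod>a\<leftarrow>eigenvalues_desc A. [:- a, 1:])"
    and "length (eigenvalues_desc A) = length es"
proof -
  have m: "mset (eigenvalues_desc A) = mset es"
    by (simp add: eigenvalues_desc_def assms proots_prod_linear)
  then show "length (eigenvalues_desc A) = length es"
    by (rule mset_eq_length)
  have "mset (map (\<lambda>a. [:- a, 1:]) (eigenvalues_desc A)) = mset (map (\<lambda>a. [:- a, 1:]) es)"
    using m by simp
  then show "char_poly A = (\<Prod>a\<leftarrow>eigenvalues_desc A. [:- a, 1:])"
    unfolding assms by (metis prod_mset_prod_list)
qed

lemma eigenvalues_desc_antimono:
  assumes "i \<le> j" "j < length (eigenvalues_desc A)"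
  shows "eigenvalues_desc A ! j \<le> eigenvalues_desc A ! i"
  using assms unfolding eigenvalues_desc_def
  by (simp add: rev_nth) (rule sorted_nth_mono, auto)

text \<open>Complete \<open>v\<close> to a basis, apply Gram-Schmidt and normalise. Gram-Schmidt
  leaves the first vector alone, so column 0 is still a multiple of \<open>v\<close>.\<close>

lemma orthonormal_extension:
  fixes v :: "real vec"
  assumes v: "v \<in> carrier_vec n" and v0: "v \<noteq> 0\<^sub>v n"
  obtains W r where "W \<in> carrier_mat n n" "W\<^sup>T * W = 1\<^sub>m n" "col W 0 = r \<cdot>\<^sub>v v"
proof -
  interpret cof_vec_space n "TYPE(real)" .
  define b where "b = basis_completion v"
  define ws where "ws = gram_schmidt n b"
  note bc = basis_completion[OF v v0, folded b_def]
  have n0: "0 < n" using v v0 by (cases n) auto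
  obtain vs where bv: "b = v # vs" using bc(6,7) n0 by (cases b) auto
  note gs = gram_schmidt_result[OF bc(2,4,5) refl, folded ws_def]
  have ws: "length ws = n" "\<And>i. i < n \<Longrightarrow> ws ! i \<in> carrier_vec n"
    using gs(3,4) bc(6) by auto
  have ws0: "ws ! 0 = v"
    using gram_schmidt_hd[OF v, of vs, folded bv, folded ws_def] ws(1) n0 by (metis hd_conv_nth less_numeral_extra(3) list.size(3))
  \<comment> \<open>The orthogonality supplied by Gram-Schmidt is sesquilinear; over the reals the
    conjugation disappears.\<close>
  have conj: "conjugate x = x" for x :: "real vec" by (rule eq_vecI) auto
  have orth: "ws ! i \<bullet> ws ! j = 0 \<longleftrightarrow> i \<noteq> j" if "i < n" "j < n" for i j
    using corthogonalD[OF gs(2)] that ws(1) by (simp add: conj)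
  define s where "s i = 1 / sqrt (ws ! i \<bullet> ws ! i)" for i
  define W where "W = mat_of_cols n (map (\<lambda>i. s i \<cdot>\<^sub>v ws ! i) [0..<n])"
  have W: "W \<in> carrier_mat n n" 
    using mat_of_cols_carrier(1)[of n "map (\<lambda>i. s i \<cdot>\<^sub>v ws ! i) [0..<n]"] by (simp add: W_def)
  have colW: "col W i = s i \<cdot>\<^sub>v ws ! i" if "i < n" for i
    unfolding W_def using that ws(2) by (subst col_mat_of_cols) auto
  have "W\<^sup>T * W = 1\<^sub>m n"
  proof (rule eq_matI)
    fix i j assume ij: "i < dim_row (1\<^sub>m n :: real mat)" "j < dim_col (1\<^sub>m n :: real mat)"
    have "(W\<^sup>T * W) $$ (i, j) = col W i \<bullet> col W j" using ij W by simp
    also have "\<dots> = (s i \<cdot>\<^sub>v ws ! i) \<bullet> (s j \<cdot>\<^sub>v ws ! j)" using ij by (simp add: colW)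
    also have "\<dots> = s j * ((s i \<cdot>\<^sub>v ws ! i) \<bullet> ws ! j)"
      using ij ws(2) by (intro scalar_prod_smult_distrib[where n = n]) auto
    also have "(s i \<cdot>\<^sub>v ws ! i) \<bullet> ws ! j = s i * (ws ! i \<bullet> ws ! j)"
      using ij ws(2) by (intro smult_scalar_prod_distrib[where n = n]) auto
    also have "s j * (s i * (ws ! i \<bullet> ws ! j)) = (if i = j then 1 else 0)"
    proof (cases "i = j")
      case True
      have "ws ! i \<bullet> ws ! i \<ge> 0" by (simp add: scalar_prod_def sum_nonneg)
      moreover have "ws ! i \<bullet> ws ! i \<noteq> 0" using orth[of i i] ij by simp
      ultimately have "ws ! i \<bullet> ws ! i > 0" by linarith
      then show ?thesis using True by (simp add: s_def)
    qed (use orth[of i j] ij in simp)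
    finally show "(W\<^sup>T * W) $$ (i, j) = 1\<^sub>m n $$ (i, j)" using ij by simp
  qed (use W in auto)
  moreover have "col W 0 = s 0 \<cdot>\<^sub>v v" using colW[OF n0] ws0 by simp
  ultimately show thesis using W that by blast
qed

text \<open>Deflation along a prescribed list of eigenvalues. An orthogonal matrix whose first
  column is an eigenvector for \<open>e\<close> splits off a block of size one, and the remaining
  symmetric block has the tail \<open>es\<close> as its roots. The order of the list is preserved on
  the diagonal.\<close>

lemma symmetric_diagonalization:
  fixes A :: "real mat"
  assumes "A \<in> carrier_mat n n" and "A\<^sup>T = A" and "char_poly A = (\<Prod>a\<leftarrow>es. [:- a, 1:])"
  shows "\<exists>P \<in> carrier_mat n n. P\<^sup>T * P = 1\<^sub>m n \<and> P\<^sup>T * A * P = mat_diag n (\<lambda>i. es ! i)"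
  using assms
proof (induct es arbitrary: n A)
  case Nil
  have "n = 0" using degree_monic_char_poly[OF Nil(1)] Nil(3) by simp
  then show ?case using Nil by (intro bexI[of _ "1\<^sub>m 0"]) (auto simp: mat_diag_def)
next
  case (Cons e es)
  note A = Cons(2) and sym = Cons(3)
  let ?n1 = "n - 1"
  have cp: "char_poly A = [: -e, 1 :] * (\<Prod>e \<leftarrow> es. [:- e, 1:])" using Cons(4) by simp
  have "eigenvalue A e" unfolding eigenvalue_root_char_poly[OF A] cp by simp
  then obtain v where v: "v \<in> carrier_vec n" "v \<noteq> 0\<^sub>v n" and Av: "A *\<^sub>v v = e \<cdot>\<^sub>v v"
    using A unfolding eigenvalue_def eigenvector_def by auto
  have n0: "0 < n" using v by (cases n) auto
  obtain W r where W: "W \<in> carrier_mat n n" and WW: "W\<^sup>T * W = 1\<^sub>m n" and W0: "col W 0 = r \<cdot>\<^sub>v v"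
    using orthonormal_extension[OF v] .
  have WT: "W\<^sup>T \<in> carrier_mat n n" using W by simp
  have WW': "W * W\<^sup>T = 1\<^sub>m n" by (rule mat_mult_left_right_inverse[OF WT W WW])
  define B where "B = W\<^sup>T * A * W"
  have B: "B \<in> carrier_mat n n" using W A unfolding B_def by simp
  have symB: "B\<^sup>T = B"
    unfolding B_def using W A sym
    by (simp add: transpose_mult[of _ n n _ n] assoc_mult_mat[of _ n n _ n _ n])
  have AW0: "A *\<^sub>v col W 0 = e \<cdot>\<^sub>v col W 0"
    unfolding W0 using A v Av by (simp add: mult_mat_vec smult_smult_assoc mult.commute)
  have B0: "B $$ (i, 0) = (if i = 0 then e else 0)" if "i < n" for i
  proof -
    have "B $$ (i, 0) = (W\<^sup>T * (A * W)) $$ (i, 0)" unfolding B_def using W A by (simp add: assoc_mult_mat[of _ n n _ n _ n])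
    also have "\<dots> = col W i \<bullet> (A *\<^sub>v col W 0)" using W A that n0 by (simp add: mult_mat_vec_def)
    also have "\<dots> = e * (W\<^sup>T * W) $$ (i, 0)" unfolding AW0 using W that n0 by simp
    finally show ?thesis unfolding WW using that n0 by simp
  qed
  have B0': "B $$ (0, i) = (if i = 0 then e else 0)" if "i < n" for i
    using B0[OF that] symB that n0 B by (metis carrier_matD index_transpose_mat(1))
  define D where "D = mat ?n1 ?n1 (\<lambda>(i,j). B $$ (Suc i, Suc j))"
  define E where "E = mat 1 1 (\<lambda>_. e)"
  have D: "D \<in> carrier_mat ?n1 ?n1" and E: "E \<in> carrier_mat 1 1" unfolding D_def E_def by auto
  let ?Z = "0\<^sub>m 1 ?n1" and ?Z' = "0\<^sub>m ?n1 1"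
  \<comment> \<open>The first column vanishes below the corner by the eigenvector equation, the
    first row by symmetry of \<open>B\<close>.\<close>
  have Bblock: "B = four_block_mat E ?Z ?Z' D"
    by (rule eq_matI) (use B B0 B0' n0 in \<open>auto simp: D_def E_def\<close>)
  have symD: "D\<^sup>T = D"
  proof (rule eq_matI)
    fix i j assume "i < dim_row D" "j < dim_col D"
    then have "Suc i < n" "Suc j < n" "i < ?n1" "j < ?n1" by (auto simp: D_def)
    moreover have "B\<^sup>T $$ (Suc i, Suc j) = B $$ (Suc i, Suc j)" unfolding symB ..
    ultimately show "D\<^sup>T $$ (i, j) = D $$ (i, j)" using B by (simp add: D_def)
  qed (auto simp: D_def)
  \<comment> \<open>Similarity and the block form factor the characteristic polynomial; cancelling
    the linear factor of \<open>e\<close> leaves the induction hypothesis applicable to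
    \<open>D\<close>.\<close>
  have "similar_mat B A"
    unfolding similar_mat_def similar_mat_wit_def Let_def
    by (intro exI[of _ "W\<^sup>T"] exI[of _ W]) (use W A WW WW' in \<open>auto simp: B_def\<close>)
  then have "char_poly A = char_poly B" by (simp add: char_poly_similar)
  also have "\<dots> = char_poly E * char_poly D"
    unfolding Bblock by (rule char_poly_four_block_zeros_col[OF E _ D]) simp
  also have "char_poly E = [: -e, 1 :]"
    by (simp add: E_def char_poly_defs det_def sign_def)
  finally have "char_poly D = (\<Prod>e \<leftarrow> es. [:- e, 1:])"
    unfolding cp by (metis mult_cancel_left pCons_eq_0_iff zero_neq_one)
  from Cons(1)[OF D symD this] obtain Q where Q: "Q \<in> carrier_mat ?n1 ?n1"
    and QQ: "Q\<^sup>T * Q = 1\<^sub>m ?n1" and QDQ: "Q\<^sup>T * D * Q = mat_diag ?n1 (\<lambda>i. es ! i)" by blast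
  \<comment> \<open>\<open>R\<close> fixes the first coordinate and diagonalises the block
    \<open>D\<close>; the matrix sought is \<open>W * R\<close>.\<close>
  define R where "R = four_block_mat (1\<^sub>m 1) ?Z ?Z' Q"
  have one: "(1\<^sub>m 1 :: real mat) \<in> carrier_mat 1 1" by simp
  have Z: "(?Z :: real mat) \<in> carrier_mat 1 ?n1" "(?Z' :: real mat) \<in> carrier_mat ?n1 1" by auto
  have R: "R \<in> carrier_mat n n" unfolding R_def using Q n0
    by (metis Suc_pred' four_block_carrier_mat one plus_1_eq_Suc)
  have QT: "Q\<^sup>T \<in> carrier_mat ?n1 ?n1" using Q by simp
  have RT: "R\<^sup>T = four_block_mat (1\<^sub>m 1) ?Z ?Z' Q\<^sup>T"
    unfolding R_def by (subst transpose_four_block_mat[OF one Z Q]) simp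
  have RR: "R\<^sup>T * R = 1\<^sub>m n"
    unfolding RT unfolding R_def
    by (subst mult_four_block_mat[OF one Z QT one Z Q]) (use Q QQ n0 in \<open>simp\<close>)
  have QTD: "Q\<^sup>T * D \<in> carrier_mat ?n1 ?n1" using QT D by simp
  have "R\<^sup>T * B = four_block_mat E ?Z ?Z' (Q\<^sup>T * D)"
    unfolding RT Bblock using QT D E QTD
    by (subst mult_four_block_mat[OF one Z QT E Z D]) simp
  then have "R\<^sup>T * B * R = four_block_mat E ?Z ?Z' (Q\<^sup>T * D * Q)"
    unfolding R_def using Q QTD E
    by (simp only:, subst mult_four_block_mat[OF E Z QTD one Z Q])
      (simp add: right_mult_zero_mat[OF QTD[unfolded One_nat_def]])
  also have "\<dots> = mat_diag n (\<lambda>i. (e # es) ! i)"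
    unfolding QDQ by (rule eq_matI) (use n0 in \<open>auto simp: E_def mat_diag_def\<close>)
  finally have RBR: "R\<^sup>T * B * R = mat_diag n (\<lambda>i. (e # es) ! i)" .
  show ?case
  proof (intro bexI[of _ "W * R"] conjI)
    show "W * R \<in> carrier_mat n n" using W R by simp
    have "(W * R)\<^sup>T * (W * R) = R\<^sup>T * (W\<^sup>T * W) * R"
      using W R by (simp add: transpose_mult[of _ n n _ n] assoc_mult_mat[of _ n n _ n _ n])
    then show "(W * R)\<^sup>T * (W * R) = 1\<^sub>m n" unfolding WW using R RR by simp
    have "(W * R)\<^sup>T * A * (W * R) = R\<^sup>T * B * R"
      unfolding B_def
      using W R A by (simp add: transpose_mult[of _ n n _ n] assoc_mult_mat[of _ n n _ n _ n])
    then show "(W * R)\<^sup>T * A * (W * R) = mat_diag n (\<lambda>i. (e # es) ! i)" unfolding RBR .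
  qed
qed

text \<open>The columns of the orthogonal matrix \<open>P\<close> become functions:
  \<open>u k i\<close> is coordinate \<open>i\<close> of eigenvector \<open>k\<close>. The two
  products of \<open>P\<close> with its transpose give orthonormality and completeness, and solving
  for \<open>A\<close> gives the last identity.\<close>

lemma symmetric_spectral_decomposition:
  fixes A :: "real mat"
  assumes A: "A \<in> carrier_mat n n" and sym: "A\<^sup>T = A"
  obtains u :: "nat \<Rightarrow> nat \<Rightarrow> real" where "length (eigenvalues_desc A) = n"
    and "\<And>k l. k < n \<Longrightarrow> l < n \<Longrightarrow> (\<Sum>i<n. u k i * u l i) = (if k = l then 1 else 0)"
    and "\<And>i j. i < n \<Longrightarrow> j < n \<Longrightarrow> (\<Sum>k<n. u k i * u k j) = (if i = j then 1 else 0)"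
    and "\<And>i j. i < n \<Longrightarrow> j < n \<Longrightarrow>
      A $$ (i, j) = (\<Sum>k<n. eigenvalues_desc A ! k * u k i * u k j)"
proof -
  obtain es where es: "char_poly A = (\<Prod>a\<leftarrow>es. [:- a, 1:])" "length es = n"
    using symmetric_char_poly_splits[OF A sym] .
  note ed = eigenvalues_desc_split[OF es(1)]
  let ?d = "\<lambda>i. eigenvalues_desc A ! i"
  obtain P where P: "P \<in> carrier_mat n n" and PP: "P\<^sup>T * P = 1\<^sub>m n"
    and PAP: "P\<^sup>T * A * P = mat_diag n ?d"
    using symmetric_diagonalization[OF A sym ed(1)] by blast
  have PT: "P\<^sup>T \<in> carrier_mat n n" using P by simp
  have PP': "P * P\<^sup>T = 1\<^sub>m n" by (rule mat_mult_left_right_inverse[OF PT P PP])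
  have "P * mat_diag n ?d * P\<^sup>T = (P * P\<^sup>T) * A * (P * P\<^sup>T)"
    unfolding PAP[symmetric] using P A by (simp add: assoc_mult_mat[of _ n n _ n _ n])
  then have A_eq: "A = P * mat_diag n ?d * P\<^sup>T" using A by (simp add: PP')
  have entry: "(M * N) $$ (i, j) = (\<Sum>k<n. M $$ (i, k) * N $$ (k, j))"
    if "M \<in> carrier_mat n n" "N \<in> carrier_mat n n" "i < n" "j < n" for M N :: "real mat" and i j
    using that by (simp add: scalar_prod_def atLeast0LessThan)
  show thesis
  proof (rule that[of "\<lambda>k i. P $$ (i, k)"])
    show "length (eigenvalues_desc A) = n" using ed(2) es(2) by simp
  next
    fix k l assume "k < n" "l < n"
    then show "(\<Sum>i<n. P $$ (i, k) * P $$ (i, l)) = (if k = l then 1 else 0)"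
      using entry[OF PT P, of k l] P by (simp add: PP)
  next
    fix i j assume "i < n" "j < n"
    then show "(\<Sum>k<n. P $$ (i, k) * P $$ (j, k)) = (if i = j then 1 else 0)"
      using entry[OF P PT, of i j] P by (simp add: PP')
  next
    fix i j assume ij: "i < n" "j < n"
    have "A $$ (i, j) = (\<Sum>k<n. (P * mat_diag n ?d) $$ (i, k) * P\<^sup>T $$ (k, j))"
      by (subst A_eq, rule entry) (use P ij in auto)
    also have "\<dots> = (\<Sum>k<n. ?d k * P $$ (i, k) * P $$ (j, k))"
      using P ij by (intro sum.cong) (auto simp: mat_diag_mult_right mult_ac)
    finally show "A $$ (i, j) = (\<Sum>k<n. ?d k * P $$ (i, k) * P $$ (j, k))" .
  qed
qed

section \<open>Cheeger inequalities for regular weights\<close>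

text \<open>A weighted graph with all degrees equal to \<open>D\<close>. Its Laplacian is
  \<open>D\<close> times the identity minus \<open>w\<close>, so the distance of an eigenvalue of
  \<open>w\<close> from \<open>D\<close> is a Laplacian eigenvalue.\<close>

locale regular_weights =
  fixes V :: "'v set" and w :: "'v \<Rightarrow> 'v \<Rightarrow> real" and D :: real
  assumes finite_V: "finite V"
    and w_sym: "\<And>i j. i \<in> V \<Longrightarrow> j \<in> V \<Longrightarrow> w i j = w j i"
    and w_nonneg: "\<And>i j. i \<in> V \<Longrightarrow> j \<in> V \<Longrightarrow> 0 \<le> w i j"
    and row_sum: "\<And>i. i \<in> V \<Longrightarrow> (\<Sum>j\<in>V. w i j) = D"
begin

definition cut :: "'v set \<Rightarrow> real" where
  "cut S = (\<Sum>i\<in>S. \<Sum>j\<in>V - S. w i j)"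

lemma cut_nonneg: "S \<subseteq> V \<Longrightarrow> 0 \<le> cut S"
  unfolding cut_def by (intro sum_nonneg w_nonneg) auto

lemma sum_row_sq: "(\<Sum>i\<in>V. \<Sum>j\<in>V. w i j * (f i)\<^sup>2) = D * (\<Sum>i\<in>V. (f i)\<^sup>2)"
  by (simp add: sum_distrib_left row_sum flip: sum_distrib_right)

lemma sum_col_sq: "(\<Sum>i\<in>V. \<Sum>j\<in>V. w i j * (f j)\<^sup>2) = D * (\<Sum>i\<in>V. (f i)\<^sup>2)"
proof -
  have "(\<Sum>i\<in>V. \<Sum>j\<in>V. w i j * (f j)\<^sup>2) = (\<Sum>i\<in>V. \<Sum>j\<in>V. w i j * (f i)\<^sup>2)"
    by (subst sum.swap) (intro sum.cong refl, simp add: w_sym)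
  then show ?thesis using sum_row_sq by simp
qed

text \<open>Expand the square; symmetry and constant row sums turn both square terms into
  \<open>D\<close> times the squared norm. The factor 2 appears because ordered pairs count every
  unordered pair twice.\<close>

lemma dirichlet_form:
  "(\<Sum>i\<in>V. \<Sum>j\<in>V. w i j * (f i - f j)\<^sup>2) =
    2 * (D * (\<Sum>i\<in>V. (f i)\<^sup>2) - (\<Sum>i\<in>V. \<Sum>j\<in>V. w i j * f i * f j))"
proof -
  have "(\<Sum>i\<in>V. \<Sum>j\<in>V. w i j * (f i - f j)\<^sup>2) =
      (\<Sum>i\<in>V. \<Sum>j\<in>V. w i j * (f i)\<^sup>2 + w i j * (f j)\<^sup>2 - 2 * (w i j * f i * f j))"
    by (intro sum.cong refl) (simp add: power2_eq_square algebra_simps)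
  also have "\<dots> = (\<Sum>i\<in>V. \<Sum>j\<in>V. w i j * (f i)\<^sup>2) + (\<Sum>i\<in>V. \<Sum>j\<in>V. w i j * (f j)\<^sup>2)
      - 2 * (\<Sum>i\<in>V. \<Sum>j\<in>V. w i j * f i * f j)"
    by (simp add: sum.distrib sum_subtractf sum_distrib_left)
  finally show ?thesis unfolding sum_row_sq sum_col_sq by simp
qed

text \<open>A pair separated by \<open>S\<close> is met in both orders, hence the factor 2. The sum
  serves both as the Dirichlet sum of an indicator and as the contribution of one level in the
  coarea argument.\<close>

lemma sum_separated:
  assumes "S \<subseteq> V"
  shows "(\<Sum>i\<in>V. \<Sum>j\<in>V. w i j * (if (i \<in> S) = (j \<in> S) then 0 else 1)) = 2 * cut S"
proof -
  have cut: "(\<Sum>i\<in>V. \<Sum>j\<in>V. w i j * (if i \<in> S \<and> j \<notin> S then 1 else 0)) = cut S"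
  proof -
    have "(\<Sum>i\<in>V. \<Sum>j\<in>V. w i j * (if i \<in> S \<and> j \<notin> S then 1 else 0)) =
        (\<Sum>i\<in>V. if i \<in> S then \<Sum>j\<in>V. if j \<notin> S then w i j else 0 else 0)"
      by (intro sum.cong refl) (auto intro!: sum.cong)
    also have "\<dots> = (\<Sum>i\<in>V \<inter> S. \<Sum>j\<in>{j\<in>V. j \<notin> S}. w i j)"
      using finite_V by (simp only: sum.inter_restrict[symmetric] sum.inter_filter[symmetric])
    also have "V \<inter> S = S" using assms by auto
    also have "{j\<in>V. j \<notin> S} = V - S" by auto
    finally show ?thesis by (simp add: cut_def)
  qed
  have "(\<Sum>i\<in>V. \<Sum>j\<in>V. w i j * (if i \<notin> S \<and> j \<in> S then 1 else 0)) =
      (\<Sum>i\<in>V. \<Sum>j\<in>V. w i j * (if i \<in> S \<and> j \<notin> S then 1 else 0))"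
    by (subst sum.swap) (intro sum.cong refl, auto simp: w_sym)
  then have "(\<Sum>i\<in>V. \<Sum>j\<in>V. w i j * (if i \<in> S \<and> j \<notin> S then 1 else 0) +
      w i j * (if i \<notin> S \<and> j \<in> S then 1 else 0)) = 2 * cut S"
    unfolding sum.distrib using cut by simp
  then show ?thesis
    by (rule trans[rotated]) (intro sum.cong refl, auto)
qed

text \<open>A discrete coarea inequality: peel off the lowest level of \<open>u\<close> on its support.\<close>

lemma sum_level_sets:
  fixes \<eta> :: real
  assumes iso: "\<And>S. S \<subseteq> V \<Longrightarrow> S \<noteq> {} \<Longrightarrow> 2 * card S \<le> card V \<Longrightarrow> \<eta> * card S \<le> cut S"
    and u: "\<And>i. i \<in> V \<Longrightarrow> 0 \<le> u i"
    and supp: "2 * card {i\<in>V. 0 < u i} \<le> card V"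
  shows "2 * \<eta> * (\<Sum>i\<in>V. u i) \<le> (\<Sum>i\<in>V. \<Sum>j\<in>V. w i j * \<bar>u i - u j\<bar>)"
  using u supp
proof (induct "card {i\<in>V. 0 < u i}" arbitrary: u rule: less_induct)
  case less
  define S where "S = {i\<in>V. 0 < u i}"
  have S: "S \<subseteq> V" "finite S" using finite_V by (auto simp: S_def)
  have off: "u i = 0" if "i \<in> V" "i \<notin> S" for i using less(2)[of i] that by (auto simp: S_def)
  show ?case
  proof (cases "S = {}")
    case True
    then have "u i = 0" if "i \<in> V" for i using off that by simp
    then show ?thesis by simp
  next
    case False
    \<comment> \<open>\<open>m\<close> is the lowest positive value. Subtracting it on
      \<open>S\<close> kills the points where it is attained, so the support shrinks strictly and
      the induction applies.\<close>
    define m where "m = Min (u ` S)"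
    have mS: "m \<in> u ` S" using S False by (simp add: m_def)
    have m0: "0 < m" using mS by (auto simp: S_def)
    have mle: "m \<le> u i" if "i \<in> S" for i using that S by (simp add: m_def)
    define u' where "u' i = (if i \<in> S then u i - m else 0)" for i
    have "{i\<in>V. 0 < u' i} \<subset> S"
    proof -
      obtain s where "s \<in> S" "u s = m" using mS by auto
      then show ?thesis by (auto simp: u'_def split: if_splits)
    qed
    then have lt: "card {i\<in>V. 0 < u' i} < card S" using S(2) by (simp add: psubset_card_mono)
    have IH: "2 * \<eta> * (\<Sum>i\<in>V. u' i) \<le> (\<Sum>i\<in>V. \<Sum>j\<in>V. w i j * \<bar>u' i - u' j\<bar>)"
    proof (rule less(1))
      show "card {i \<in> V. 0 < u' i} < card {i \<in> V. 0 < u i}" using lt by (simp add: S_def)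
      show "0 \<le> u' i" for i using mle by (simp add: u'_def)
      show "2 * card {i \<in> V. 0 < u' i} \<le> card V" using lt less(3) by (simp add: S_def)
    qed
    \<comment> \<open>Inside \<open>S\<close> both values drop by \<open>m\<close>, outside both are
      zero, and across the boundary of \<open>S\<close> the difference drops by exactly
      \<open>m\<close>.\<close>
    have split: "\<bar>u i - u j\<bar> = \<bar>u' i - u' j\<bar> + m * (if (i \<in> S) = (j \<in> S) then 0 else 1)"
      if "i \<in> V" "j \<in> V" for i j
      using mle[of i] mle[of j] off[of i] off[of j] m0 that by (auto simp: u'_def)
    have "(\<Sum>i\<in>V. \<Sum>j\<in>V. w i j * \<bar>u i - u j\<bar>) =
      (\<Sum>i\<in>V. \<Sum>j\<in>V. w i j * \<bar>u' i - u' j\<bar> + m * (w i j * (if (i \<in> S) = (j \<in> S) then 0 else 1)))"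
      by (intro sum.cong refl) (simp add: split distrib_left)
    also have "\<dots> = (\<Sum>i\<in>V. \<Sum>j\<in>V. w i j * \<bar>u' i - u' j\<bar>) + m * (2 * cut S)"
      unfolding sum_separated[OF S(1), symmetric] by (simp only: sum.distrib sum_distrib_left)
    finally have rhs: "(\<Sum>i\<in>V. \<Sum>j\<in>V. w i j * \<bar>u i - u j\<bar>) =
      (\<Sum>i\<in>V. \<Sum>j\<in>V. w i j * \<bar>u' i - u' j\<bar>) + m * (2 * cut S)" .
    have "(\<Sum>i\<in>V. u i) = (\<Sum>i\<in>V. u' i + (if i \<in> S then m else 0))"
      by (intro sum.cong refl) (auto simp: u'_def off)
    also have "\<dots> = (\<Sum>i\<in>V. u' i) + m * card S"
      using S finite_V by (simp add: sum.distrib sum.inter_restrict[symmetric] Int_absorb1 Int_absorb2)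
    finally have lhs: "(\<Sum>i\<in>V. u i) = (\<Sum>i\<in>V. u' i) + m * card S" .
    \<comment> \<open>\<open>S\<close> is the support of \<open>u\<close>, which has at most half of
      the vertices, so the isoperimetric hypothesis applies to it.\<close>
    have "\<eta> * card S \<le> cut S" using iso[OF S(1) False] less(3) by (simp add: S_def)
    then have "m * (\<eta> * card S) \<le> m * cut S" using m0 by simp
    then show ?thesis unfolding lhs rhs using IH by (simp add: algebra_simps)
  qed
qed

text \<open>Factor the difference of squares and give each factor a weight
  \<open>sqrt (w i j)\<close>; then use Cauchy-Schwarz over ordered pairs.\<close>

lemma cauchy_schwarz_differences:
  "(\<Sum>i\<in>V. \<Sum>j\<in>V. w i j * \<bar>(g i)\<^sup>2 - (g j)\<^sup>2\<bar>)\<^sup>2 \<le>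
    (\<Sum>i\<in>V. \<Sum>j\<in>V. w i j * (g i - g j)\<^sup>2) * (\<Sum>i\<in>V. \<Sum>j\<in>V. w i j * (g i + g j)\<^sup>2)"
proof -
  define p where "p = (\<lambda>(i, j). sqrt (w i j) * \<bar>g i - g j\<bar>)"
  define q where "q = (\<lambda>(i, j). sqrt (w i j) * \<bar>g i + g j\<bar>)"
  have "(\<Sum>i\<in>V. \<Sum>j\<in>V. w i j * \<bar>(g i)\<^sup>2 - (g j)\<^sup>2\<bar>) = (\<Sum>z\<in>V \<times> V. p z * q z)"
    unfolding sum.cartesian_product
  proof (intro sum.cong refl, clarify)
    fix i j assume "i \<in> V" "j \<in> V"
    then have "sqrt (w i j) * sqrt (w i j) = w i j" by (simp add: w_nonneg)
    moreover have "\<bar>(g i)\<^sup>2 - (g j)\<^sup>2\<bar> = \<bar>g i - g j\<bar> * \<bar>g i + g j\<bar>"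
      unfolding abs_mult[symmetric] by (simp add: power2_eq_square algebra_simps)
    ultimately show "w i j * \<bar>(g i)\<^sup>2 - (g j)\<^sup>2\<bar> = p (i, j) * q (i, j)"
      by (simp add: p_def q_def mult_ac flip: mult.assoc[of "sqrt (w i j)" "sqrt (w i j)"])
  qed
  moreover have "(\<Sum>i\<in>V. \<Sum>j\<in>V. w i j * (g i - g j)\<^sup>2) = (\<Sum>z\<in>V \<times> V. (p z)\<^sup>2)"
    unfolding sum.cartesian_product p_def
    by (intro sum.cong refl) (auto simp: w_nonneg power_mult_distrib)
  moreover have "(\<Sum>i\<in>V. \<Sum>j\<in>V. w i j * (g i + g j)\<^sup>2) = (\<Sum>z\<in>V \<times> V. (q z)\<^sup>2)"
    unfolding sum.cartesian_product q_def
    by (intro sum.cong refl) (auto simp: w_nonneg power_mult_distrib)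
  ultimately show ?thesis using Cauchy_Schwarz_ineq_sum[of p q "V \<times> V"] by simp
qed

text \<open>Apply the coarea inequality to the square of the positive part of the eigenvector.\<close>

lemma cheeger_positive_part:
  fixes \<eta> :: real
  assumes iso: "\<And>S. S \<subseteq> V \<Longrightarrow> S \<noteq> {} \<Longrightarrow> 2 * card S \<le> card V \<Longrightarrow> \<eta> * card S \<le> cut S"
    and "0 \<le> \<eta>"
    and eig: "\<And>i. i \<in> V \<Longrightarrow> (\<Sum>j\<in>V. w i j * f j) = (D - \<mu>) * f i"
    and P: "{i\<in>V. 0 < f i} \<noteq> {}" "2 * card {i\<in>V. 0 < f i} \<le> card V"
  shows "\<eta>\<^sup>2 \<le> 2 * D * \<mu>"
proof -
  define g where "g i = max 0 (f i)" for i
  define G where "G = (\<Sum>i\<in>V. (g i)\<^sup>2)"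
  have G0: "0 < G"
  proof -
    obtain i where "i \<in> V" "0 < f i" using P by auto
    then have "0 < (g i)\<^sup>2" by (simp add: g_def)
    then show ?thesis unfolding G_def using finite_V \<open>i \<in> V\<close> by (intro sum_pos2) auto
  qed
  \<comment> \<open>Passing from \<open>f\<close> to \<open>g\<close> can only increase the values
    at the other vertices, and the weights are nonnegative, so the eigenvalue equation becomes an
    inequality where \<open>f i\<close> is positive. Elsewhere both sides vanish.\<close>
  have row: "(D - \<mu>) * (g i)\<^sup>2 \<le> (\<Sum>j\<in>V. w i j * g i * g j)" if i: "i \<in> V" for i
  proof (cases "0 < f i")
    case True
    have "(D - \<mu>) * f i \<le> (\<Sum>j\<in>V. w i j * g j)"
      unfolding eig[OF i, symmetric] by (intro sum_mono mult_left_mono w_nonneg i) (auto simp: g_def)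
    then have "f i * ((D - \<mu>) * f i) \<le> f i * (\<Sum>j\<in>V. w i j * g j)" using True by simp
    moreover have "g i = f i" using True by (simp add: g_def)
    ultimately show ?thesis by (simp add: power2_eq_square sum_distrib_left mult_ac)
  qed (simp add: g_def max_def)
  have "(D - \<mu>) * G \<le> (\<Sum>i\<in>V. \<Sum>j\<in>V. w i j * g i * g j)"
    unfolding G_def sum_distrib_left by (intro sum_mono row)
  then have E: "(\<Sum>i\<in>V. \<Sum>j\<in>V. w i j * (g i - g j)\<^sup>2) \<le> 2 * \<mu> * G"
    unfolding dirichlet_form G_def[symmetric] by (simp add: algebra_simps)
  have "(\<Sum>i\<in>V. \<Sum>j\<in>V. w i j * (g i + g j)\<^sup>2) \<le>
      (\<Sum>i\<in>V. \<Sum>j\<in>V. 2 * (w i j * (g i)\<^sup>2) + 2 * (w i j * (g j)\<^sup>2))"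
  proof (intro sum_mono)
    fix i j assume "i \<in> V" "j \<in> V"
    have "(g i + g j)\<^sup>2 \<le> 2 * (g i)\<^sup>2 + 2 * (g j)\<^sup>2"
      using zero_le_power2[of "g i - g j"] by (simp add: power2_eq_square algebra_simps)
    then show "w i j * (g i + g j)\<^sup>2 \<le> 2 * (w i j * (g i)\<^sup>2) + 2 * (w i j * (g j)\<^sup>2)"
      using mult_left_mono[OF _ w_nonneg[OF \<open>i \<in> V\<close> \<open>j \<in> V\<close>]] by (fastforce simp: algebra_simps)
  qed
  also have "\<dots> = 4 * D * G"
    unfolding sum.distrib sum_distrib_left[symmetric] sum_row_sq sum_col_sq G_def by simp
  finally have F: "(\<Sum>i\<in>V. \<Sum>j\<in>V. w i j * (g i + g j)\<^sup>2) \<le> 4 * D * G" .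
  have "2 * \<eta> * G \<le> (\<Sum>i\<in>V. \<Sum>j\<in>V. w i j * \<bar>(g i)\<^sup>2 - (g j)\<^sup>2\<bar>)"
    unfolding G_def
  proof (rule sum_level_sets[OF iso])
    have "{i \<in> V. 0 < (g i)\<^sup>2} = {i \<in> V. 0 < f i}" by (auto simp: g_def max_def)
    then show "2 * card {i \<in> V. 0 < (g i)\<^sup>2} \<le> card V" using P by simp
  qed auto
  then have "(2 * \<eta> * G)\<^sup>2 \<le> (\<Sum>i\<in>V. \<Sum>j\<in>V. w i j * \<bar>(g i)\<^sup>2 - (g j)\<^sup>2\<bar>)\<^sup>2"
    using \<open>0 \<le> \<eta>\<close> G0 by (intro power_mono) auto
  also note cauchy_schwarz_differences
  also have "(\<Sum>i\<in>V. \<Sum>j\<in>V. w i j * (g i - g j)\<^sup>2) * (\<Sum>i\<in>V. \<Sum>j\<in>V. w i j * (g i + g j)\<^sup>2) \<le>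
      (2 * \<mu> * G) * (4 * D * G)"
  proof (rule mult_mono[OF E F])
    show "0 \<le> (\<Sum>i\<in>V. \<Sum>j\<in>V. w i j * (g i + g j)\<^sup>2)"
      by (intro sum_nonneg mult_nonneg_nonneg w_nonneg) auto
    have "0 \<le> (\<Sum>i\<in>V. \<Sum>j\<in>V. w i j * (g i - g j)\<^sup>2)"
      by (intro sum_nonneg mult_nonneg_nonneg w_nonneg) auto
    then show "0 \<le> 2 * \<mu> * G" using E by linarith
  qed
  \<comment> \<open>The chain bounds \<open>(2 * \<eta> * G)\<^sup>2\<close> by
    \<open>8 * D * \<mu> * G\<^sup>2\<close>; the positive factor \<open>4 * G\<^sup>2\<close> is
    cancelled next.\<close>
  finally have "\<eta>\<^sup>2 * (4 * G\<^sup>2) \<le> (2 * D * \<mu>) * (4 * G\<^sup>2)"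
    by (simp add: power2_eq_square algebra_simps)
  then show ?thesis using G0 by (simp only: mult_le_cancel_right) auto
qed

text \<open>A nonzero function with sum zero takes both signs. Its positive and negative supports
  are disjoint, so one of them has at most half of the vertices, and the eigenvalue equation
  survives a change of sign.\<close>

lemma cheeger_lower_bound:
  fixes \<eta> :: real
  assumes iso: "\<And>S. S \<subseteq> V \<Longrightarrow> S \<noteq> {} \<Longrightarrow> 2 * card S \<le> card V \<Longrightarrow> \<eta> * card S \<le> cut S"
    and "0 \<le> \<eta>"
    and eig: "\<And>i. i \<in> V \<Longrightarrow> (\<Sum>j\<in>V. w i j * f j) = (D - \<mu>) * f i"
    and orth: "(\<Sum>i\<in>V. f i) = 0" and nz: "i \<in> V" "f i \<noteq> 0"
  shows "\<eta>\<^sup>2 \<le> 2 * D * \<mu>"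
proof -
  let ?P = "{i\<in>V. 0 < f i}" and ?N = "{i\<in>V. 0 < - f i}"
  have "card ?P + card ?N = card (?P \<union> ?N)"
    using finite_V by (intro card_Un_disjoint[symmetric]) auto
  also have "\<dots> \<le> card V" using finite_V by (intro card_mono) auto
  finally have le: "card ?P + card ?N \<le> card V" .
  have P: "?P \<noteq> {}"
  proof
    assume "?P = {}"
    then have "\<And>i. i \<in> V \<Longrightarrow> 0 \<le> - f i" by force
    then have "\<forall>i\<in>V. - f i = 0"
      using orth finite_V sum_nonneg_eq_0_iff[of V "\<lambda>i. - f i"] by (simp add: sum_negf)
    then show False using nz by auto
  qed
  have N: "?N \<noteq> {}"
  proof
    assume "?N = {}"
    then have "\<And>i. i \<in> V \<Longrightarrow> 0 \<le> f i" by force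
    then have "\<forall>i\<in>V. f i = 0"
      using orth finite_V sum_nonneg_eq_0_iff[of V f] by simp
    then show False using nz by auto
  qed
  show ?thesis
  proof (cases "2 * card ?P \<le> card V")
    case True
    show ?thesis by (rule cheeger_positive_part[OF iso \<open>0 \<le> \<eta>\<close> eig P True])
  next
    case False
    show ?thesis
    proof (rule cheeger_positive_part[OF iso \<open>0 \<le> \<eta>\<close> _ N])
      show "(\<Sum>j\<in>V. w i j * - f j) = (D - \<mu>) * - f i" if "i \<in> V" for i
        using eig[OF that] by (simp add: sum_negf)
    qed (use False le in auto)
  qed
qed

lemma dirichlet_form_nonneg:
  "(\<Sum>i\<in>V. \<Sum>j\<in>V. w i j * f i * f j) \<le> D * (\<Sum>i\<in>V. (f i)\<^sup>2)"
proof -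
  have "0 \<le> (\<Sum>i\<in>V. \<Sum>j\<in>V. w i j * (f i - f j)\<^sup>2)"
    by (intro sum_nonneg mult_nonneg_nonneg w_nonneg) auto
  then show ?thesis unfolding dirichlet_form by simp
qed

end

section \<open>Rayleigh quotients in an orthonormal eigenbasis and the two bounds on the spectral
  gap\<close>

lemma spectral_form:
  fixes l x :: "nat \<Rightarrow> real"
  shows "(\<Sum>i<n. \<Sum>j<n. (\<Sum>k<n. l k * u k i * u k j) * x i * x j) =
    (\<Sum>k<n. l k * (\<Sum>i<n. u k i * x i)\<^sup>2)"
proof -
  have "(\<Sum>i<n. \<Sum>j<n. (\<Sum>k<n. l k * u k i * u k j) * x i * x j) =
      (\<Sum>i<n. \<Sum>j<n. \<Sum>k<n. l k * ((u k i * x i) * (u k j * x j)))"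
    by (intro sum.cong refl) (simp add: sum_distrib_left sum_distrib_right mult_ac)
  also have "\<dots> = (\<Sum>i<n. \<Sum>k<n. \<Sum>j<n. l k * ((u k i * x i) * (u k j * x j)))"
    by (intro sum.cong refl sum.swap)
  also have "\<dots> = (\<Sum>k<n. \<Sum>i<n. \<Sum>j<n. l k * ((u k i * x i) * (u k j * x j)))"
    by (rule sum.swap)
  also have "\<dots> = (\<Sum>k<n. l k * (\<Sum>i<n. u k i * x i)\<^sup>2)"
    by (intro sum.cong refl) (simp only: power2_eq_square sum_product, simp only: sum_distrib_left)
  finally show ?thesis .
qed

text \<open>Indices start at 0, so \<open>l 0\<close> and \<open>l 1\<close> are the two largest
  eigenvalues of \<open>w\<close>, counted with multiplicity.\<close>

locale regular_spectrum = regular_weights "{..<n}" w D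
  for n :: nat and w :: "nat \<Rightarrow> nat \<Rightarrow> real" and D :: real +
  fixes l :: "nat \<Rightarrow> real" and u :: "nat \<Rightarrow> nat \<Rightarrow> real"
  assumes antimono: "\<And>i j. i \<le> j \<Longrightarrow> j < n \<Longrightarrow> l j \<le> l i"
    and orthonormal: "\<And>k m. k < n \<Longrightarrow> m < n \<Longrightarrow> (\<Sum>i<n. u k i * u m i) = (if k = m then 1 else 0)"
    and complete: "\<And>i j. i < n \<Longrightarrow> j < n \<Longrightarrow> (\<Sum>k<n. u k i * u k j) = (if i = j then 1 else 0)"
    and spectral: "\<And>i j. i < n \<Longrightarrow> j < n \<Longrightarrow> w i j = (\<Sum>k<n. l k * u k i * u k j)"
begin

lemma quadratic_form:
  "(\<Sum>i<n. \<Sum>j<n. w i j * x i * x j) = (\<Sum>k<n. l k * (\<Sum>i<n. u k i * x i)\<^sup>2)"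
  unfolding spectral_form[symmetric] by (intro sum.cong refl) (simp add: spectral)

text \<open>Completeness writes the identity matrix in the eigenbasis with all eigenvalues 1, which
  is an instance of \<open>spectral_form\<close>.\<close>

lemma parseval: "(\<Sum>i<n. (x i)\<^sup>2) = (\<Sum>k<n. (\<Sum>i<n. u k i * x i)\<^sup>2)"
proof -
  have "(\<Sum>i<n. (x i)\<^sup>2) = (\<Sum>i<n. \<Sum>j<n. (if i = j then 1 else 0) * x i * x j)"
    by (simp add: power2_eq_square if_distrib[of "\<lambda>t. t * _"] cong: if_cong)
  also have "\<dots> = (\<Sum>i<n. \<Sum>j<n. (\<Sum>k<n. 1 * u k i * u k j) * x i * x j)"
    by (intro sum.cong refl) (simp add: complete)
  finally show ?thesis unfolding spectral_form by simp
qed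

lemma eigenvector:
  assumes "k < n" "i < n"
  shows "(\<Sum>j<n. w i j * u k j) = l k * u k i"
proof -
  have "(\<Sum>j<n. w i j * u k j) = (\<Sum>j<n. \<Sum>m<n. l m * u m i * (u m j * u k j))"
    using assms by (intro sum.cong refl) (simp add: spectral sum_distrib_right sum_distrib_left mult_ac)
  also have "\<dots> = (\<Sum>m<n. l m * u m i * (\<Sum>j<n. u m j * u k j))"
    by (subst sum.swap) (simp add: sum_distrib_left)
  also have "\<dots> = (\<Sum>m<n. if m = k then l k * u k i else 0)"
    using assms by (intro sum.cong refl) (auto simp: orthonormal)
  finally show ?thesis using assms by simp
qed

text \<open>Nonnegativity of the Dirichlet form bounds the Rayleigh quotient of \<open>u 0\<close>
  by \<open>D\<close>; conversely the constant function has Rayleigh quotient \<open>D\<close>,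
  which cannot exceed \<open>l 0\<close>.\<close>

lemma largest_eigenvalue:
  assumes "0 < n"
  shows "l 0 = D"
proof (rule antisym)
  have "(\<Sum>i<n. \<Sum>j<n. w i j * u 0 i * u 0 j) = (\<Sum>i<n. u 0 i * (l 0 * u 0 i))"
    using assms by (intro sum.cong refl) (simp add: eigenvector[symmetric] sum_distrib_left mult_ac)
  also have "\<dots> = l 0 * (\<Sum>i<n. u 0 i * u 0 i)" by (simp add: sum_distrib_left mult_ac)
  finally show "l 0 \<le> D"
    using dirichlet_form_nonneg[of "u 0"] orthonormal[OF assms assms] by (simp add: power2_eq_square)
  have "D * n = (\<Sum>i<n. \<Sum>j<n. w i j * 1 * 1)" by (simp add: row_sum)
  also have "\<dots> \<le> (\<Sum>k<n. l 0 * (\<Sum>i<n. u k i * 1)\<^sup>2)"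
    unfolding quadratic_form by (intro sum_mono mult_right_mono antimono) auto
  also have "\<dots> = l 0 * (\<Sum>i<n. 1\<^sup>2)"
    unfolding parseval[of "\<lambda>_. 1"] by (simp add: sum_distrib_left)
  finally show "D \<le> l 0" using assms by simp
qed

text \<open>The coordinate of \<open>x\<close> along \<open>u 0\<close> vanishes, and every other
  eigenvalue is at most \<open>l 1\<close>.\<close>

lemma rayleigh_second:
  assumes "2 \<le> n" and "(\<Sum>i<n. u 0 i * x i) = 0"
  shows "(\<Sum>i<n. \<Sum>j<n. w i j * x i * x j) \<le> l 1 * (\<Sum>i<n. (x i)\<^sup>2)"
proof -
  have "l k * (\<Sum>i<n. u k i * x i)\<^sup>2 \<le> l 1 * (\<Sum>i<n. u k i * x i)\<^sup>2" if "k < n" for k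
    using assms(2) that by (cases "k = 0") (auto intro!: mult_right_mono antimono)
  then show ?thesis
    unfolding quadratic_form parseval[of x] sum_distrib_left by (intro sum_mono) auto
qed

text \<open>The test vector lies in the span of the constants and the indicator of \<open>W\<close> and is
  orthogonal to the top eigenvector, which need not be constant if the top eigenvalue is multiple.\<close>

lemma spectral_gap_upper:
  assumes n: "2 \<le> n" and W: "W \<subseteq> {..<n}" "2 * card W \<le> n"
  shows "(l 0 - l 1) * card W \<le> 2 * cut W"
proof (cases "D \<le> l 1")
  case True
  then have "(l 0 - l 1) * card W \<le> 0"
    using n by (simp add: largest_eigenvalue mult_nonpos_nonneg)
  then show ?thesis using cut_nonneg[OF W(1)] by simp
next
  case False
  define p where "p = (\<Sum>i<n. u 0 i)"
  \<comment> \<open>If \<open>u 0\<close> were orthogonal to the constants, their Rayleigh quotient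
    \<open>D\<close> would be at most \<open>l 1\<close>.\<close>
  have "p \<noteq> 0"
  proof
    assume "p = 0"
    then have "(\<Sum>i<n. \<Sum>j<n. w i j * 1 * 1) \<le> l 1 * (\<Sum>i<n. 1\<^sup>2)"
      using n by (intro rayleigh_second) (auto simp: p_def)
    then have "D * n \<le> l 1 * n" by (simp add: row_sum mult.commute)
    then show False using False n by simp
  qed
  define q where "q = (\<Sum>i<n. u 0 i * (if i \<in> W then 1 else 0))"
  \<comment> \<open>The shift \<open>a\<close> makes the coordinate of \<open>x\<close> along
    \<open>u 0\<close> vanish.\<close>
  define a where "a = - q / p"
  define x where "x i = a + (if i \<in> W then 1 else 0)" for i
  have "(\<Sum>i<n. u 0 i * x i) = p * a + q"
    unfolding x_def distrib_left sum.distrib q_def[symmetric] p_def sum_distrib_right ..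
  then have "(\<Sum>i<n. u 0 i * x i) = 0" using \<open>p \<noteq> 0\<close> by (simp add: a_def)
  note ray = rayleigh_second[OF n this]
  \<comment> \<open>A constant shift does not change differences, so \<open>x\<close> has the
    Dirichlet sum of the indicator of \<open>W\<close>.\<close>
  have "(\<Sum>i<n. \<Sum>j<n. w i j * (x i - x j)\<^sup>2) =
      (\<Sum>i<n. \<Sum>j<n. w i j * (if (i \<in> W) = (j \<in> W) then 0 else 1))"
    by (intro sum.cong refl) (auto simp: x_def)
  then have "cut W = D * (\<Sum>i<n. (x i)\<^sup>2) - (\<Sum>i<n. \<Sum>j<n. w i j * x i * x j)"
    unfolding dirichlet_form sum_separated[OF W(1)] by simp
  then have c: "(D - l 1) * (\<Sum>i<n. (x i)\<^sup>2) \<le> cut W"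
    using ray by (simp add: algebra_simps)
  have fin: "finite W" using W(1) finite_subset by auto
  have "(\<Sum>i<n. (x i)\<^sup>2) = (\<Sum>i\<in>W. (x i)\<^sup>2) + (\<Sum>i\<in>{..<n} - W. (x i)\<^sup>2)"
    using W(1) by (metis finite_lessThan add.commute sum.subset_diff)
  also have "\<dots> = card W * (a + 1)\<^sup>2 + (n - card W) * a\<^sup>2"
    using W fin by (simp add: x_def card_Diff_subset)
  finally have sq: "(\<Sum>i<n. (x i)\<^sup>2) = card W * (a + 1)\<^sup>2 + (n - card W) * a\<^sup>2" .
  \<comment> \<open>The complement is at least as large as \<open>W\<close>, and
    \<open>(a + 1)\<^sup>2 + a\<^sup>2\<close> has minimum 1/2, at \<open>a = -1/2\<close>. The
    squared norm of \<open>x\<close> is thus at least half of \<open>card W\<close>, whence the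
    factor 2 in the bound.\<close>
  have "card W * a\<^sup>2 \<le> (n - card W) * a\<^sup>2"
    using W(2) by (intro mult_right_mono) auto
  moreover have "1 / 2 \<le> (a + 1)\<^sup>2 + a\<^sup>2"
    using zero_le_power2[of "2 * a + 1"] by (simp add: power2_eq_square algebra_simps)
  then have "card W * (1 / 2) \<le> card W * ((a + 1)\<^sup>2 + a\<^sup>2)" by (intro mult_left_mono) auto
  ultimately have "card W / 2 \<le> (\<Sum>i<n. (x i)\<^sup>2)"
    unfolding sq by (simp add: algebra_simps)
  then have "(D - l 1) * (card W / 2) \<le> (D - l 1) * (\<Sum>i<n. (x i)\<^sup>2)"
    using False by (intro mult_left_mono) auto
  then show ?thesis using c n by (simp add: largest_eigenvalue)
qed

text \<open>Apply \<open>cheeger_lower_bound\<close> with \<open>\<mu> = l 0 - l 1\<close>. The task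
  is to find an eigenfunction for \<open>l 1\<close> with sum zero, since \<open>u 1\<close> may
  fail to have this property when the top eigenvalue is multiple.\<close>

lemma spectral_gap_lower:
  fixes \<eta> :: real
  assumes n: "2 \<le> n"
    and iso: "\<And>S. S \<subseteq> {..<n} \<Longrightarrow> S \<noteq> {} \<Longrightarrow> 2 * card S \<le> n \<Longrightarrow> \<eta> * card S \<le> cut S"
    and "0 \<le> \<eta>"
  shows "\<eta>\<^sup>2 \<le> 2 * D * (l 0 - l 1)"
proof -
  have D: "l 0 = D" using n by (simp add: largest_eigenvalue)
  have "\<exists>f. (\<forall>i<n. (\<Sum>j<n. w i j * f j) = l 1 * f i) \<and> (\<Sum>i<n. f i) = 0 \<and> (\<exists>i<n. f i \<noteq> 0)"
  proof (cases "(\<Sum>i<n. u 1 i) = 0")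
    case True
    have "\<exists>i<n. u 1 i \<noteq> 0"
    proof (rule ccontr)
      assume "\<not> ?thesis"
      then have "(\<Sum>i<n. u 1 i * u 1 i) = 0" by simp
      then show False using orthonormal[of 1 1] n by simp
    qed
    then show ?thesis using True eigenvector[of 1] n by (intro exI[of _ "u 1"]) auto
  next
    case False
    define p0 p1 where "p0 = (\<Sum>i<n. u 0 i)" and "p1 = (\<Sum>i<n. u 1 i)"
    \<comment> \<open>Summing the eigenvector equation over all vertices gives
      \<open>l 1 * p1 = D * p1\<close>, so a nonzero sum forces \<open>l 1 = D\<close>.\<close>
    have "l 1 * p1 = (\<Sum>i<n. \<Sum>j<n. w i j * u 1 j)"
      using n by (simp add: p1_def sum_distrib_left eigenvector)
    also have "\<dots> = (\<Sum>j<n. \<Sum>i<n. w j i * u 1 j)"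
      by (subst sum.swap) (intro sum.cong refl, simp add: w_sym)
    also have "\<dots> = D * p1" by (simp add: p1_def sum_distrib_left row_sum flip: sum_distrib_right)
    finally have l1: "l 1 = D" using False by (simp add: p1_def)
    \<comment> \<open>Now \<open>u 0\<close> and \<open>u 1\<close> share the eigenvalue
      \<open>D\<close>. This combination cancels their sums and is nonzero, because its coordinate
      along \<open>u 0\<close> is \<open>p1\<close>.\<close>
    define f where "f i = p1 * u 0 i - p0 * u 1 i" for i
    have "(\<Sum>j<n. w i j * f j) = l 1 * f i" if "i < n" for i
    proof -
      have "(\<Sum>j<n. w i j * f j) = p1 * (\<Sum>j<n. w i j * u 0 j) - p0 * (\<Sum>j<n. w i j * u 1 j)"
        by (simp add: f_def right_diff_distrib sum_subtractf sum_distrib_left mult_ac)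
      also have "\<dots> = p1 * (l 1 * u 0 i) - p0 * (l 1 * u 1 i)"
        using n that l1 D by (simp add: eigenvector)
      finally show ?thesis by (simp add: f_def algebra_simps)
    qed
    moreover have "(\<Sum>i<n. f i) = 0"
      by (simp add: f_def sum_subtractf p0_def p1_def flip: sum_distrib_left)
    moreover have "\<exists>i<n. f i \<noteq> 0"
    proof (rule ccontr)
      assume "\<not> ?thesis"
      then have "0 = (\<Sum>i<n. f i * u 0 i)" by simp
      also have "\<dots> = p1 * (\<Sum>i<n. u 0 i * u 0 i) - p0 * (\<Sum>i<n. u 1 i * u 0 i)"
        by (simp add: f_def right_diff_distrib sum_subtractf sum_distrib_left mult_ac)
      also have "\<dots> = p1" using n orthonormal[of 0 0] orthonormal[of 1 0] by simp
      finally show False using False by (simp add: p1_def)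
    qed
    ultimately show ?thesis by blast
  qed
  then obtain f i where "\<forall>i<n. (\<Sum>j<n. w i j * f j) = l 1 * f i" "(\<Sum>i<n. f i) = 0"
    "i < n" "f i \<noteq> 0" by blast
  then show ?thesis
    using iso \<open>0 \<le> \<eta>\<close> D by (intro cheeger_lower_bound[where f = f and i = i]) auto
qed

end

section \<open>The Cheeger constant of a graph\<close>

text \<open>With at least two vertices the minimum runs over a finite nonempty set, so it is a real
  number attained at some \<open>W\<close>. The ratios are multiplied out to match the isoperimetric
  hypothesis of the spectral bounds.\<close>

lemma cheeger_attained:
  assumes fin: "finite (fst G)" and card: "2 \<le> card (fst G)"
  obtains r W where "cheeger G = ereal r"
    and "\<And>S. S \<subseteq> fst G \<Longrightarrow> S \<noteq> {} \<Longrightarrow> 2 * card S \<le> card (fst G) \<Longrightarrow>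
      r * card S \<le> card (edge_boundary G S)"
    and "W \<subseteq> fst G" "W \<noteq> {}" "2 * card W \<le> card (fst G)"
    and "r * card W = card (edge_boundary G W)"
proof -
  define ratio where "ratio S = real (card (edge_boundary G S)) / real (card S)" for S
  define adm where "adm = {S. S \<noteq> {} \<and> S \<subset> fst G \<and> real (card S) \<le> real (card (fst G)) / 2}"
  have adm_iff: "S \<in> adm \<longleftrightarrow> S \<subseteq> fst G \<and> S \<noteq> {} \<and> 2 * card S \<le> card (fst G)" for S
    using card by (auto simp: adm_def)
  have pos: "0 < card S" if "S \<in> adm" for S
    using that fin finite_subset[of S "fst G"] by (simp add: adm_iff card_gt_0_iff)
  have "adm \<subseteq> Pow (fst G)" by (auto simp: adm_def)
  then have "finite adm" using fin by (simp add: finite_subset)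
  then have finR: "finite ((\<lambda>S. ereal (ratio S)) ` adm)" by simp
  obtain v where "v \<in> fst G" using card by fastforce
  then have "{v} \<in> adm" using card by (simp add: adm_iff)
  then have ne: "(\<lambda>S. ereal (ratio S)) ` adm \<noteq> {}" by auto
  have ch: "cheeger G = Min ((\<lambda>S. ereal (ratio S)) ` adm)"
  proof -
    have "{ereal (ratio W) |W. W \<noteq> {} \<and> W \<subset> fst G \<and> real (card W) \<le> real (card (fst G)) / 2}
        = (\<lambda>S. ereal (ratio S)) ` adm"
      by (auto simp: adm_def)
    then show ?thesis using card unfolding cheeger_def ratio_def by simp
  qed
  obtain W where W: "W \<in> adm" "cheeger G = ereal (ratio W)"
    using Min_in[OF finR ne] unfolding ch by auto
  show thesis
  proof (rule that[of "ratio W" W])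
    fix S assume "S \<subseteq> fst G" "S \<noteq> {}" "2 * card S \<le> card (fst G)"
    then have S: "S \<in> adm" by (simp add: adm_iff)
    then have "cheeger G \<le> ereal (ratio S)" unfolding ch using finR by (intro Min_le) auto
    then have "ratio W \<le> ratio S" unfolding W(2) by simp
    then have "ratio W * card S \<le> ratio S * card S" by (intro mult_right_mono) auto
    then show "ratio W * card S \<le> card (edge_boundary G S)"
      using pos[OF S] by (simp add: ratio_def)
  qed (use W pos[OF W(1)] in \<open>auto simp: adm_iff ratio_def\<close>)
qed

text \<open>A boundary edge has a unique orientation pointing out of \<open>W\<close>, so boundary
  edges can be counted by ordered pairs.\<close>

lemma bij_betw_edge_boundary:
  assumes edges: "\<And>f. f \<in> snd G \<Longrightarrow> \<exists>i\<in>fst G. \<exists>j\<in>fst G. i \<noteq> j \<and> f = {i, j}"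
    and W: "W \<subseteq> fst G"
  shows "bij_betw (\<lambda>(i, j). {i, j}) {(i, j) \<in> W \<times> (fst G - W). {i, j} \<in> snd G} (edge_boundary G W)"
  unfolding bij_betw_def
proof
  show "inj_on (\<lambda>(i, j). {i, j}) {(i, j) \<in> W \<times> (fst G - W). {i, j} \<in> snd G}"
    by (auto simp: inj_on_def doubleton_eq_iff)
  show "(\<lambda>(i, j). {i, j}) ` {(i, j) \<in> W \<times> (fst G - W). {i, j} \<in> snd G} = edge_boundary G W"
  proof (intro equalityI subsetI)
    fix f assume "f \<in> (\<lambda>(i, j). {i, j}) ` {(i, j) \<in> W \<times> (fst G - W). {i, j} \<in> snd G}"
    then obtain i j where ij: "f = {i, j}" "i \<in> W" "j \<notin> W" "f \<in> snd G" by auto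
    then have "f \<inter> W = {i}" by auto
    then show "f \<in> edge_boundary G W" using ij by (simp add: edge_boundary_def)
  next
    fix f assume f: "f \<in> edge_boundary G W"
    then obtain i j where ij: "i \<in> fst G" "j \<in> fst G" "i \<noteq> j" "f = {i, j}"
      using edges[of f] by (auto simp: edge_boundary_def)
    have one: "card ({i, j} \<inter> W) = 1" using f ij by (simp add: edge_boundary_def)
    have "(i \<in> W) \<noteq> (j \<in> W)" using one \<open>i \<noteq> j\<close> by (auto simp: Int_insert_left split: if_splits)
    moreover have "{i, j} \<in> snd G" "{j, i} \<in> snd G" "f = {j, i}"
      using f ij by (auto simp: edge_boundary_def insert_commute)
    ultimately show "f \<in> (\<lambda>(i, j). {i, j}) ` {(i, j) \<in> W \<times> (fst G - W). {i, j} \<in> snd G}"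
      using ij
      by (cases "i \<in> W")
        (auto intro: rev_image_eqI[of "(i, j)"] rev_image_eqI[of "(j, i)"])
  qed
qed

lemma sum_adjacency_cut:
  fixes c :: real
  assumes "finite (fst G)" "W \<subseteq> fst G"
    and "\<And>f. f \<in> snd G \<Longrightarrow> \<exists>i\<in>fst G. \<exists>j\<in>fst G. i \<noteq> j \<and> f = {i, j}"
  shows "(\<Sum>i\<in>W. \<Sum>j\<in>fst G - W. if {i, j} \<in> snd G then c else 0) = c * card (edge_boundary G W)"
proof -
  have fin: "finite (W \<times> (fst G - W))" using assms(1,2) finite_subset by auto
  have "(\<Sum>i\<in>W. \<Sum>j\<in>fst G - W. if {i, j} \<in> snd G then c else 0) =
      (\<Sum>z\<in>W \<times> (fst G - W). if (case z of (i, j) \<Rightarrow> {i, j} \<in> snd G) then c else 0)"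
    unfolding sum.cartesian_product by (intro sum.cong) auto
  also have "\<dots> = (\<Sum>z\<in>{(i, j) \<in> W \<times> (fst G - W). {i, j} \<in> snd G}. c)"
    unfolding sum.inter_filter[OF fin, symmetric] by (intro sum.cong) auto
  also have "\<dots> = c * card (edge_boundary G W)"
    using bij_betw_same_card[OF bij_betw_edge_boundary[OF assms(3,2)]] by simp
  finally show ?thesis .
qed

section \<open>From the evolution algebra to regular weights, and back to the Cheeger
  constant\<close>

theorem theorem7p3:
  fixes mul :: "'a::real_vector \<Rightarrow> 'a \<Rightarrow> 'a"
    and e :: "nat \<Rightarrow> 'a" and n d :: nat and c :: real
    and A :: "real mat" and lam :: "real list" and h :: ereal
  defines "A \<equiv> structural_matrix mul n e"
    and "lam \<equiv> eigenvalues_desc A"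
    and "h \<equiv> cheeger_evolution mul n e"
  assumes "n \<ge> 1"
    and "expander_evolution_algebra mul n e"
    and "symmetric_evolution mul n e"
    and "regular_evolution d mul n e"
    and "c > 0"
    and "\<And>i j. i < n \<Longrightarrow> j < n \<Longrightarrow> {i, j} \<in> snd (evolution_graph mul n e) \<Longrightarrow> A $$ (i, j) = c"
    and "\<And>i j. i < n \<Longrightarrow> j < n \<Longrightarrow> {i, j} \<notin> snd (evolution_graph mul n e) \<Longrightarrow> A $$ (i, j) = 0"
    and "\<And>i. i < n \<Longrightarrow> A $$ (i, i) = 0"
  shows "length lam = n \<and> lam ! 0 = c * real d \<and>
    (n \<ge> 2 \<longrightarrow>
      ereal ((c * real d)\<^sup>2) * h\<^sup>2 / ereal (2 * (real d)\<^sup>2 * lam ! 0) \<le> ereal (lam ! 0 - lam ! 1) \<and>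
      ereal (lam ! 0 - lam ! 1) \<le> ereal (2 * c) * h \<and>
      ereal (lam ! 0 - lam ! 1) \<ge> ereal c * h\<^sup>2 / ereal (2 * real d))"
proof -
  define G where "G = evolution_graph mul n e"
  define w where "w i j = A $$ (i, j)" for i j
  have V: "fst G = {..<n}" by (simp add: G_def evolution_graph_def)
  have edges: "\<And>f. f \<in> snd G \<Longrightarrow> \<exists>i\<in>fst G. \<exists>j\<in>fst G. i \<noteq> j \<and> f = {i, j}"
    by (auto simp: G_def evolution_graph_def)
  have A: "A \<in> carrier_mat n n" by (simp add: A_def structural_matrix_def)
  have w_eq: "w i j = (if {i, j} \<in> snd G then c else 0)" if "i < n" "j < n" for i j
    using that assms(9,10) by (simp add: w_def G_def)
  have w_sym: "w i j = w j i" if "i < n" "j < n" for i j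
    using that by (simp add: w_eq insert_commute)
  have A_sym: "A\<^sup>T = A"
    by (rule eq_matI) (use A w_sym in \<open>auto simp: w_def\<close>)
  have row: "(\<Sum>j<n. w i j) = c * real d" if i: "i < n" for i
  proof -
    have "(\<Sum>j<n. w i j) = (\<Sum>j<n. if {i, j} \<in> snd G then c else 0)"
      using i by (intro sum.cong refl) (simp add: w_eq)
    also have "\<dots> = (\<Sum>j\<in>neighbours G i. c)"
      unfolding neighbours_def V by (rule sum.inter_filter[symmetric]) simp
    also have "\<dots> = c * real d"
      using assms(7) i V by (simp add: regular_evolution_def regular_graph_def G_def)
    finally show ?thesis .
  qed
  show ?thesis
  proof (rule symmetric_spectral_decomposition[OF A A_sym, folded lam_def])
    fix u :: "nat \<Rightarrow> nat \<Rightarrow> real"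
    assume len: "length lam = n"
      and u: "\<And>k m. k < n \<Longrightarrow> m < n \<Longrightarrow> (\<Sum>i<n. u k i * u m i) = (if k = m then 1 else 0)"
        "\<And>i j. i < n \<Longrightarrow> j < n \<Longrightarrow> (\<Sum>k<n. u k i * u k j) = (if i = j then 1 else 0)"
        "\<And>i j. i < n \<Longrightarrow> j < n \<Longrightarrow> A $$ (i, j) = (\<Sum>k<n. lam ! k * u k i * u k j)"
    have anti: "lam ! j \<le> lam ! i" if "i \<le> j" "j < n" for i j
      using eigenvalues_desc_antimono[of i j A] that len unfolding lam_def by blast
    interpret regular_weights "{..<n}" w "c * real d"
      by (rule regular_weights.intro) (use row w_sym w_eq \<open>c > 0\<close> in auto)
    interpret regular_spectrum n w "c * real d" "\<lambda>k. lam ! k" u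
      by (intro regular_spectrum.intro regular_spectrum_axioms.intro regular_weights_axioms)
        (fact anti u[folded w_def])+
    have lam0: "lam ! 0 = c * real d" using largest_eigenvalue assms(4) by simp
    have cut_eq: "cut W = c * card (edge_boundary G W)" if "W \<subseteq> {..<n}" for W
    proof -
      have "cut W = (\<Sum>i\<in>W. \<Sum>j\<in>fst G - W. if {i, j} \<in> snd G then c else 0)"
        unfolding cut_def V using that by (intro sum.cong refl) (auto simp: w_eq)
      then show ?thesis using sum_adjacency_cut[OF _ _ edges] that by (simp add: V)
    qed
    \<comment> \<open>Since \<open>lam\<close> has length \<open>n\<close>, the entry
      \<open>lam ! 1\<close> exists once \<open>n\<close> is at least 2; in that range
      \<open>h\<close> is finite and the claims become inequalities between reals.\<close>
    have "ereal ((c * real d)\<^sup>2) * h\<^sup>2 / ereal (2 * (real d)\<^sup>2 * lam ! 0) \<le> ereal (lam ! 0 - lam ! 1) \<and>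
        ereal (lam ! 0 - lam ! 1) \<le> ereal (2 * c) * h \<and>
        ereal (lam ! 0 - lam ! 1) \<ge> ereal c * h\<^sup>2 / ereal (2 * real d)" if n: "2 \<le> n"
    proof -
      obtain r W where r: "cheeger G = ereal r"
        and iso: "\<And>S. S \<subseteq> fst G \<Longrightarrow> S \<noteq> {} \<Longrightarrow> 2 * card S \<le> card (fst G) \<Longrightarrow>
          r * card S \<le> card (edge_boundary G S)"
        and W: "W \<subseteq> fst G" "W \<noteq> {}" "2 * card W \<le> card (fst G)"
          "r * card W = card (edge_boundary G W)"
        using cheeger_attained[of G] n unfolding V by auto
      have h: "h = ereal r" using r by (simp add: h_def cheeger_evolution_def G_def)
      have r0: "0 < r"
        using assms(5) h by (simp add: expander_evolution_algebra_def h_def)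
      \<comment> \<open>Cuts are \<open>c\<close> times edge counts, so the isoperimetric constant
        of the weights is \<open>c * r\<close>. One factor \<open>c\<close> is cancelled
        afterwards.\<close>
      have "(c * r)\<^sup>2 \<le> 2 * (c * real d) * (lam ! 0 - lam ! 1)"
      proof (rule spectral_gap_lower[OF n])
        show "c * r * card S \<le> cut S" if "S \<subseteq> {..<n}" "S \<noteq> {}" "2 * card S \<le> n" for S
          using iso[of S] that \<open>c > 0\<close> by (simp add: cut_eq V)
      qed (use r0 \<open>c > 0\<close> in simp)
      then have "c * (c * r\<^sup>2) \<le> c * (2 * real d * (lam ! 0 - lam ! 1))"
        by (simp add: power2_eq_square algebra_simps)
      then have low: "c * r\<^sup>2 \<le> 2 * real d * (lam ! 0 - lam ! 1)" using \<open>c > 0\<close> by simp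
      \<comment> \<open>The expander hypothesis enters here: \<open>d = 0\<close> would contradict
        \<open>r > 0\<close>. The later divisions by \<open>d\<close> are therefore genuine.\<close>
      have d0: "0 < real d"
      proof (rule ccontr)
        assume "\<not> ?thesis"
        then have "c * r\<^sup>2 \<le> 0" using low by simp
        then show False using r0 \<open>c > 0\<close> by (simp add: mult_le_0_iff)
      qed
      have low': "c * r\<^sup>2 / (2 * real d) \<le> lam ! 0 - lam ! 1"
        using low d0 by (simp add: field_simps)
      have cW: "0 < card W" using W(1,2) V finite_subset[of W "{..<n}"] by (simp add: card_gt_0_iff)
      have "(lam ! 0 - lam ! 1) * card W \<le> 2 * (c * (r * card W))"
        using spectral_gap_upper[OF n, of W] W by (simp add: cut_eq V)
      then have "(lam ! 0 - lam ! 1) * card W \<le> (2 * c * r) * card W" by simp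
      then have up: "lam ! 0 - lam ! 1 \<le> 2 * c * r" using cW by (simp only: mult_le_cancel_right)
      \<comment> \<open>After inserting \<open>lam ! 0 = c * real d\<close>, both lower bounds in
        the claim are the same number.\<close>
      have "(c * real d)\<^sup>2 * r\<^sup>2 / (2 * (real d)\<^sup>2 * lam ! 0) = c * r\<^sup>2 / (2 * real d)"
        unfolding lam0 using d0 \<open>c > 0\<close> by (simp add: field_simps power2_eq_square)
      moreover have "2 * (real d)\<^sup>2 * lam ! 0 \<noteq> 0" using d0 \<open>c > 0\<close> lam0 by simp
      ultimately show ?thesis
        using low' up d0 unfolding h by (simp add: power2_eq_square)
    qed
    then show ?thesis using len lam0 by blast
  qed
qed

end
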